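(* There are infinitely many triangular numbers which are products of two tetrahedral numbers; i.e., there are infinitely many positive integers $z$ (giving infinitely many distinct values $t_z$) such that $t_z = T_x T_y$ for some positive integers $x, y$.
   Context: $t_n = \frac{n(n+1)}{2}$ is the $n$-th triangular number and $T_n = \frac{n(n+1)(n+2)}{6}$ is the $n$-th tetrahedral number. *)

theory Defs
  imports Complex_Main "HOL-Library.Nat_Bijection"
begin

text \<open>
  The triangular number \<open>t\<^sub>n = n(n+1)/2\<close> is \<^const>\<open>triangle\<close> from
  \<^theory>\<open>HOL-Library.Nat_Bijection\<close>. The truncating divisions are exact, as the two lemmas
  below confirm.
\<close>

definition tetrahedral :: "nat \<Rightarrow> nat" where
  "tetrahedral n = (n * (n + 1) * (n + 2)) div 6"

lemma real_triangle: "real (triangle n) = real n * (real n + 1) / 2"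
  by (induction n) (simp_all add: field_simps)

lemma tetrahedral_Suc: "tetrahedral (Suc n) = tetrahedral n + triangle (Suc n)"
proof -
  have even: "2 dvd (n + 1) * (n + 2)" by simp
  then obtain k where k: "(n + 1) * (n + 2) = 2 * k" by (elim dvdE)
  then have tri: "triangle (Suc n) = k" by (simp add: triangle_def)
  have "Suc n * (Suc n + 1) * (Suc n + 2) = n * (n + 1) * (n + 2) + 3 * ((n + 1) * (n + 2))"
    by (simp add: algebra_simps)
  also have "\<dots> = n * (n + 1) * (n + 2) + k * 6" by (simp only: k)
  finally show ?thesis
    unfolding tetrahedral_def tri by simp
qed

lemma real_tetrahedral: "real (tetrahedral n) = real n * (real n + 1) * (real n + 2) / 6"
proof (induction n)
  case 0
  show ?case by (simp add: tetrahedral_def)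
next
  case (Suc n)
  then show ?case
    unfolding tetrahedral_Suc of_nat_add real_triangle by (simp add: field_simps)
qed

end

theory Submission
  imports Defs "HOL-Library.Infinite_Set"
begin

text \<open>
  If \<open>T\<^sub>x = 3v\<close>, then \<open>T\<^sub>x T\<^bsub>v-1\<^esub> = 3v \<cdot> (v-1)v(v+1)/6 = (v\<^sup>2-1)v\<^sup>2/2\<close> is the triangular
  number with index \<open>v\<^sup>2-1\<close>. Every \<open>x\<close> divisible by 18 qualifies.
\<close>

lemma triangle_eq_tetrahedral_mult:
  assumes "tetrahedral x = 3 * Suc y"
  shows "triangle ((Suc y)\<^sup>2 - 1) = tetrahedral x * tetrahedral y"
proof -
  \<comment> \<open>The natural subtraction does not truncate, as \<open>(Suc y)\<^sup>2\<close> is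
    at least 1; over the reals the divisions by 2 and 6 become field arithmetic.\<close>
  have "real ((Suc y)\<^sup>2 - 1) = (real y + 1)\<^sup>2 - 1"
    by (simp add: power2_eq_square algebra_simps)
  then have "real (triangle ((Suc y)\<^sup>2 - 1)) = real (tetrahedral x * tetrahedral y)"
    by (simp add: real_triangle real_tetrahedral assms power2_eq_square field_simps)
  then show ?thesis
    by (simp only: of_nat_eq_iff)
qed

text \<open>In 18 = 6 * 3, the 6 cancels the denominator and the 3 is the factor that
  \<open>triangle_eq_tetrahedral_mult\<close> asks for.\<close>

lemma tetrahedral_18_mult: "tetrahedral (18 * j) = 3 * (j * (18 * j + 1) * (18 * j + 2))"
  by (simp add: tetrahedral_def)

lemma le_triangle: "n \<le> triangle n"
  by (induction n) simp_all

lemma exists_large_triangle_eq_tetrahedral_mult: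
  "\<exists>z>n. \<exists>x>0. \<exists>y>0. triangle z = tetrahedral x * tetrahedral y"
proof -
  \<comment> \<open>This is a third of \<open>tetrahedral (18 * Suc n)\<close>; \<open>Suc n\<close>
    keeps that index positive even for \<open>n = 0\<close>.\<close>
  define v where "v = Suc n * (18 * Suc n + 1) * (18 * Suc n + 2)"
  \<comment> \<open>The 2 leaves room for \<open>y = v - 1\<close> to exceed
    \<open>n\<close>.\<close>
  have "v \<ge> n + 2"
    unfolding v_def by (simp add: algebra_simps)
  then obtain y where y: "v = Suc y" "y > n"
    by (cases v) auto
  have "triangle ((Suc y)\<^sup>2 - 1) = tetrahedral (18 * Suc n) * tetrahedral y"
    using tetrahedral_18_mult[of "Suc n"] y(1)
    by (intro triangle_eq_tetrahedral_mult) (simp only: v_def)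
  moreover have "n < (Suc y)\<^sup>2 - 1"
    using y(2) by (simp add: power2_eq_square)
  ultimately show ?thesis
    using y(2) by (metis gr_zeroI less_nat_zero_code mult_pos_pos zero_less_Suc zero_less_numeral)
qed

theorem theorem5p2:
  "infinite {z :: nat. z > 0 \<and> (\<exists>x y :: nat. x > 0 \<and> y > 0 \<and>
      triangle z = tetrahedral x * tetrahedral y)} \<and>
   infinite {t :: nat. \<exists>z x y :: nat. z > 0 \<and> x > 0 \<and> y > 0 \<and>
      t = triangle z \<and> t = tetrahedral x * tetrahedral y}"
proof (unfold infinite_nat_iff_unbounded, intro conjI allI)
  fix n :: nat
  obtain z x y where *: "z > n" "x > 0" "y > 0" "triangle z = tetrahedral x * tetrahedral y"
    using exists_large_triangle_eq_tetrahedral_mult by blast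
  \<comment> \<open>One \<open>z\<close> serves both sets: the index exceeds \<open>n\<close>, and
    so does its triangular number, which is at least \<open>z\<close>.\<close>
  then have "z > 0" "triangle z > n"
    using le_triangle[of z] by simp_all
  with * show "\<exists>m>n. m \<in> {z. z > 0 \<and> (\<exists>x y. x > 0 \<and> y > 0 \<and>
      triangle z = tetrahedral x * tetrahedral y)}"
    and "\<exists>m>n. m \<in> {t. \<exists>z x y. z > 0 \<and> x > 0 \<and> y > 0 \<and>
      t = triangle z \<and> t = tetrahedral x * tetrahedral y}"
    by blast+
qed

end
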